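(* Let $f=(f^1,f^2)$ be a $2$-link function such that $(f^1)'$ is decreasing on $\mathbb{R}_+$ and $K_\gamma=g(\gamma)$ for every $\gamma>0$ (with $g,K_\gamma$ as in the context). Let $\alpha\in(0,1/8)$. Then there exists a constant $c>0$ such that, for all $m_1,m_2\ge2$, $1\le r\le \min(m_1,m_2)$, $\gamma>0$ (and all sample sizes $n\ge 1$ and sampling distributions $\Pi$ on $[m_1]\times[m_2]$), $$\inf_{\hat X}\ \sup_{\bar X\in\mathcal F(r,\gamma)}\ \mathbb{P}_{\bar X}\left(\frac{\|\hat X-\bar X\|_2^2}{m_1m_2}>c\min\left\{\gamma^2,\frac{Mr}{nK_0}\right\}\right)\ \ge\ \delta(\alpha,M),$$ where $M=\max(m_1,m_2)$ and $$\delta(\alpha,M)=\frac{1}{1+2^{-rM/16}}\left(1-2\alpha-\frac12\sqrt{\frac{\alpha}{\log(2)\,(rM)}}\right).$$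
   Context: $[n]=\{1,\dots,n\}$. For a matrix $X$, $\|X\|_2$ is the Frobenius norm and $\|X\|_\infty=\max_{i,j}|X_{i,j}|$. A $2$-link function is a map $f=(f^1,f^2):\mathbb{R}\to\{(a,b):a,b\ge0,\ a+b=1\}$; here $f^1$ is differentiable with values in $(0,1)$, $g(x)=\dfrac{((f^1)'(x))^2}{8f^1(x)(1-f^1(x))}$ and $K_\gamma=\inf_{|x|\le\gamma}g(x)$ for $\gamma\ge0$ (so $K_0=g(0)$), with $K_\gamma>0$. $\mathcal F(r,\gamma)=\{\bar X\in\mathbb{R}^{m_1\times m_2}:\mathrm{rank}(\bar X)\le r,\ \|\bar X\|_\infty\le\gamma\}$. $\mathbb{P}_{X}$ denotes the distribution of the observations $(\omega_i,Y_i)_{i=1}^n$ when the parameter is $X\in\mathbb{R}^{m_1\times m_2}$: the pairs $(\omega_i,Y_i)$ are i.i.d., $\omega_i\in[m_1]\times[m_2]$ has distribution $\Pi$, and conditionally on $\omega_i$, $Y_i=j$ with probability $f^j(X_{\omega_i})$ for $j\in\{1,2\}$. The infimum $\inf_{\hat X}$ is over all estimators $\hat X$ (measurable $\mathbb{R}^{m_1\times m_2}$-valued functions of $(\omega_i,Y_i)_{i=1}^n$). *)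

theory Defs
  imports "HOL-Probability.Probability" "Jordan_Normal_Form.DL_Rank"
begin

definition frobenius_norm :: "real mat \<Rightarrow> real" where
  "frobenius_norm X = sqrt (\<Sum>i<dim_row X. \<Sum>j<dim_col X. (X $$ (i, j))\<^sup>2)"

text \<open>Only meaningful for matrices with at least one row and one column.\<close>

definition max_norm :: "real mat \<Rightarrow> real" where
  "max_norm X = Max ((\<lambda>k. \<bar>X $$ k\<bar>) ` ({..<dim_row X} \<times> {..<dim_col X}))"

definition low_rank_class :: "nat \<Rightarrow> nat \<Rightarrow> nat \<Rightarrow> real \<Rightarrow> real mat set" where
  "low_rank_class m1 m2 r \<gamma> =
     {X \<in> carrier_mat m1 m2. vec_space.rank m1 X \<le> r \<and> max_norm X \<le> \<gamma>}"

definition link2 :: "(real \<Rightarrow> real \<times> real) \<Rightarrow> bool" where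
  "link2 f \<longleftrightarrow> (\<forall>x. fst (f x) \<ge> 0 \<and> snd (f x) \<ge> 0 \<and> fst (f x) + snd (f x) = 1)"

definition g_link :: "(real \<Rightarrow> real \<times> real) \<Rightarrow> real \<Rightarrow> real" where
  "g_link f x = (deriv (\<lambda>t. fst (f t)) x)\<^sup>2 / (8 * fst (f x) * (1 - fst (f x)))"

definition K_link :: "(real \<Rightarrow> real \<times> real) \<Rightarrow> real \<Rightarrow> real" where
  "K_link f \<gamma> = (INF x\<in>{x. \<bar>x\<bar> \<le> \<gamma>}. g_link f x)"

text \<open>
  An observation is a pair of a matrix position and a label in \<open>{1, 2}\<close>; positions are
  counted from \<open>0\<close>, in accordance with matrix indexing.
\<close>

type_synonym obs = "(nat \<times> nat) \<times> nat"

definition label_pmf :: "(real \<Rightarrow> real \<times> real) \<Rightarrow> real \<Rightarrow> nat pmf" where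
  "label_pmf f x = map_pmf (\<lambda>b. if b then 1 else 2) (bernoulli_pmf (fst (f x)))"

lemma pmf_label_pmf:
  assumes "link2 f"
  shows "pmf (label_pmf f x) 1 = fst (f x)" and "pmf (label_pmf f x) 2 = snd (f x)"
proof -
  let ?h = "\<lambda>b. if b then 1 else (2::nat)"
  have inj: "inj ?h"
    by (auto simp: inj_def)
  have p: "fst (f x) \<ge> 0" "fst (f x) \<le> 1" "snd (f x) = 1 - fst (f x)"
    using assms unfolding link2_def by (smt (verit))+
  show "pmf (label_pmf f x) 1 = fst (f x)"
    using pmf_map_inj'[OF inj, of "bernoulli_pmf (fst (f x))" True] p
    by (simp add: label_pmf_def)
  show "pmf (label_pmf f x) 2 = snd (f x)"
    using pmf_map_inj'[OF inj, of "bernoulli_pmf (fst (f x))" False] p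
    by (simp add: label_pmf_def)
qed

definition obs_pmf ::
  "(real \<Rightarrow> real \<times> real) \<Rightarrow> (nat \<times> nat) pmf \<Rightarrow> real mat \<Rightarrow> obs pmf" where
  "obs_pmf f P X = bind_pmf P (\<lambda>\<omega>. map_pmf (\<lambda>y. (\<omega>, y)) (label_pmf f (X $$ \<omega>)))"

definition sample_law ::
  "(real \<Rightarrow> real \<times> real) \<Rightarrow> (nat \<times> nat) pmf \<Rightarrow> nat \<Rightarrow> real mat \<Rightarrow> (nat \<Rightarrow> obs) measure" where
  "sample_law f P n X = PiM {1..n} (\<lambda>_. measure_pmf (obs_pmf f P X))"

text \<open>
  The sample space carries the same \<open>\<sigma>\<close>-algebra as \<^const>\<open>sample_law\<close>. Measurability of a
  matrix-valued map means measurability of all its entries.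
\<close>

definition sample_space :: "nat \<Rightarrow> (nat \<Rightarrow> obs) measure" where
  "sample_space n = PiM {1..n} (\<lambda>_. count_space UNIV)"

definition estimators :: "nat \<Rightarrow> nat \<Rightarrow> nat \<Rightarrow> ((nat \<Rightarrow> obs) \<Rightarrow> real mat) set" where
  "estimators n m1 m2 =
     {Xh. (\<forall>d\<in>space (sample_space n). Xh d \<in> carrier_mat m1 m2) \<and>
          (\<forall>i<m1. \<forall>j<m2. (\<lambda>d. Xh d $$ (i, j)) \<in> borel_measurable (sample_space n))}"

definition minimax_risk ::
  "(real \<Rightarrow> real \<times> real) \<Rightarrow> (nat \<times> nat) pmf \<Rightarrow> nat \<Rightarrow> nat \<Rightarrow> nat \<Rightarrow> nat \<Rightarrow> real \<Rightarrow> real \<Rightarrow> real" where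
  "minimax_risk f P n m1 m2 r \<gamma> s =
     (INF Xh\<in>estimators n m1 m2. SUP X\<in>low_rank_class m1 m2 r \<gamma>.
        measure (sample_law f P n X)
          {d \<in> space (sample_law f P n X).
             (frobenius_norm (Xh d - X))\<^sup>2 / (real m1 * real m2) > s})"

definition delta_bound :: "real \<Rightarrow> nat \<Rightarrow> nat \<Rightarrow> real" where
  "delta_bound \<alpha> r M =
     1 / (1 + 2 powr (- (real r * real M) / 16)) *
     (1 - 2 * \<alpha> - 1 / 2 * sqrt (\<alpha> / (ln 2 * (real r * real M))))"

end

theory Submission
  imports Defs
begin

text \<open>
  All \<open>2^D\<close> matrices with entries in \<open>{0, \<tau>}\<close> obtained by repeating an \<open>M \<times> r\<close> pattern along
  the shorter side serve as hypotheses, where \<open>D = r M\<close>. A single estimate is close to at most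
  \<open>2^(D/4)\<close> of them, since such patterns lie in a common Hamming ball of radius \<open>D/48\<close>.
  By Cauchy--Schwarz against the law of the zero matrix, with \<open>\<chi>\<^sup>2\<close>-divergence at most
  \<open>(1 + 8 K\<^sub>0 \<tau>\<^sup>2)^n - 1\<close>, the average probability of being close to the truth is at most
  \<open>1 / (1 + 2^(D/16)) + \<alpha>\<close> when \<open>\<tau>\<^sup>2\<close> is a small multiple of \<open>min {\<gamma>\<^sup>2, D / (n K\<^sub>0)}\<close>.
  Using overlapping events for all patterns replaces the Varshamov--Gilbert packing, and making
  the multiple depend on \<open>\<alpha>\<close> gives the constant \<open>1/2\<close> in front of the square root.
\<close>

section \<open>Block matrices: rank, norm and separation\<close>

lemma rank_sum_products_le:
  fixes a b :: "nat \<Rightarrow> nat \<Rightarrow> real"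
  shows "vec_space.rank m1 (mat m1 m2 (\<lambda>(i, j). \<Sum>l<r. a l i * b l j)) \<le> r"
proof (induction r)
  case 0
  have "mat m1 m2 (\<lambda>(i, j). \<Sum>l<0. a l i * b l j) = 0\<^sub>m m1 m2"
    by auto
  then show ?case by (simp only: vec_space.rank_0I)
next
  case (Suc r)
  let ?A = "mat m1 m2 (\<lambda>(i, j). \<Sum>l<r. a l i * b l j)"
  let ?B = "mat m1 m2 (\<lambda>(i, j). a r i * b r j)"
  have eq: "mat m1 m2 (\<lambda>(i, j). \<Sum>l<Suc r. a l i * b l j) = ?A + ?B"
    by (rule eq_matI) auto
  have "vec_space.rank m1 (?A + ?B) \<le> vec_space.rank m1 ?A + vec_space.rank m1 ?B"
    by (rule vec_space.rank_subadditive) auto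
  moreover have "vec_space.rank m1 ?B \<le> 1"
    by (rule vec_space.rank_le_1_product_entries[where f = "a r" and g = "b r"]) auto
  ultimately show ?case unfolding eq using Suc by linarith
qed

text \<open>The coordinate along the longer side comes first and the other one is reduced modulo
  \<open>r\<close>, so that both shapes of matrix share the pattern set
  \<open>{..<max m1 m2} \<times> {..<r}\<close>.\<close>

definition block_pos :: "nat \<Rightarrow> nat \<Rightarrow> nat \<Rightarrow> nat \<times> nat \<Rightarrow> nat \<times> nat" where
  "block_pos m1 m2 r k =
     (if m2 \<le> m1 then (fst k, snd k mod r) else (snd k, fst k mod r))"

definition block_mat :: "nat \<Rightarrow> nat \<Rightarrow> nat \<Rightarrow> real \<Rightarrow> (nat \<times> nat) set \<Rightarrow> real mat" where
  "block_mat m1 m2 r \<tau> S = mat m1 m2 (\<lambda>k. if block_pos m1 m2 r k \<in> S then \<tau> else 0)"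

text \<open>An entry sees the index along the shorter side only through its residue. The matrix is
  therefore a sum of \<open>r\<close> products, each of one line of the pattern with the indicator
  of one residue class.\<close>

lemma rank_block_mat_le:
  assumes "r \<ge> 1"
  shows "vec_space.rank m1 (block_mat m1 m2 r \<tau> S) \<le> r"
proof -
  have sel: "(\<Sum>l<r. (if k mod r = l then 1 else 0) * h l) = h (k mod r)"
    "(\<Sum>l<r. h l * (if k mod r = l then 1 else 0)) = h (k mod r)" for k and h :: "nat \<Rightarrow> real"
    using assms by (simp_all add: if_distrib[of "\<lambda>x. x * _"] if_distrib[of "\<lambda>x. _ * x"] sum.delta' cong: if_cong)
  show ?thesis
  proof (cases "m2 \<le> m1")
    case True
    have "block_mat m1 m2 r \<tau> S = mat m1 m2 (\<lambda>(i, j). \<Sum>l<r. (if (i, l) \<in> S then \<tau> else 0) *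
            (if j mod r = l then 1 else 0))"
      by (rule eq_matI) (simp_all add: block_mat_def block_pos_def True sel)
    then show ?thesis
      using rank_sum_products_le[of m1 m2 "\<lambda>l i. if (i, l) \<in> S then \<tau> else 0"
          "\<lambda>l j. if j mod r = l then 1 else 0" r] by simp
  next
    case False
    have "block_mat m1 m2 r \<tau> S = mat m1 m2 (\<lambda>(i, j). \<Sum>l<r. (if i mod r = l then 1 else 0) *
            (if (j, l) \<in> S then \<tau> else 0))"
      by (rule eq_matI) (use False in \<open>simp_all add: block_mat_def block_pos_def sel\<close>)
    then show ?thesis
      using rank_sum_products_le[of m1 m2 "\<lambda>l i. if i mod r = l then 1 else 0"
          "\<lambda>l j. if (j, l) \<in> S then \<tau> else 0" r] by simp
  qed
qed

lemma block_mat_in_low_rank_class: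
  assumes "r \<ge> 1" "m1 \<ge> 1" "m2 \<ge> 1" "0 \<le> \<tau>" "\<tau> \<le> \<gamma>"
  shows "block_mat m1 m2 r \<tau> S \<in> low_rank_class m1 m2 r \<gamma>"
proof -
  have ne: "{..<m1} \<times> {..<m2} \<noteq> {}" using assms by (auto simp: lessThan_empty_iff)
  have "max_norm (block_mat m1 m2 r \<tau> S) \<le> \<gamma>"
    unfolding max_norm_def using ne assms
    by (subst Max_le_iff) (auto simp: block_mat_def)
  then show ?thesis
    using rank_block_mat_le[OF assms(1)] by (simp add: low_rank_class_def block_mat_def)
qed

lemma frobenius_norm_square:
  "X \<in> carrier_mat m1 m2 \<Longrightarrow> (frobenius_norm X)\<^sup>2 = (\<Sum>k\<in>{..<m1} \<times> {..<m2}. (X $$ k)\<^sup>2)"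
  unfolding frobenius_norm_def by (simp add: sum_nonneg sum.cartesian_product)

text \<open>Every pattern position recurs once in each full copy of the pattern, and there are
  \<open>min m1 m2 div r\<close> full copies.\<close>

lemma card_block_pos_fibre:
  assumes "1 \<le> r" "r \<le> min m1 m2" "b \<in> {..<max m1 m2} \<times> {..<r}"
  shows "min m1 m2 \<le> 2 * r * card {k \<in> {..<m1} \<times> {..<m2}. block_pos m1 m2 r k = b}"
proof -
  obtain i l where b: "b = (i, l)" "i < max m1 m2" "l < r" using assms(3) by auto
  let ?m = "min m1 m2"
  let ?F = "{k \<in> {..<m1} \<times> {..<m2}. block_pos m1 m2 r k = b}"
  \<comment> \<open>\<open>e q\<close> is the occurrence of \<open>b\<close> in copy number
    \<open>q\<close>; a possible incomplete last copy is ignored.\<close>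
  define e where "e = (\<lambda>q. if m2 \<le> m1 then (i, q * r + l) else (q * r + l, i))"
  have inj: "inj_on e {..<?m div r}"
    using assms(1) by (auto simp: e_def inj_on_def)
  have "q * r + l < ?m" if "q < ?m div r" for q
  proof -
    have "q * r + l < (q + 1) * r" using b by simp
    also have "\<dots> \<le> (?m div r) * r" using that by (intro mult_right_mono) auto
    also have "\<dots> \<le> ?m" by (rule div_times_less_eq_dividend)
    finally show ?thesis .
  qed
  then have "e ` {..<?m div r} \<subseteq> ?F"
    using b assms(1) by (auto simp: e_def block_pos_def min_def max_def split: if_splits)
  then have "?m div r \<le> card ?F"
    using card_mono[of ?F "e ` {..<?m div r}"] card_image[OF inj] by simp
  \<comment> \<open>Since \<open>r\<close> is at most the shorter side, there is at least one full
    copy, so the remainder costs no more than the factor 2.\<close>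
  moreover have "?m \<le> 2 * r * (?m div r)"
  proof -
    have "?m = r * (?m div r) + ?m mod r" by simp
    moreover have "?m mod r \<le> r" using assms(1) by simp
    moreover have "r * 1 \<le> r * (?m div r)"
      using assms(1,2) by (intro mult_left_mono) (auto simp: Suc_le_eq div_greater_zero_iff)
    ultimately show ?thesis by linarith
  qed
  ultimately show ?thesis by (meson le_trans mult_le_mono2)
qed

text \<open>Each position where the patterns differ contributes \<tau>^2 on its whole fibre, and
  fibres are disjoint. Squared Frobenius distance thus dominates a multiple of Hamming distance; the
  form without division suits the later cancellation.\<close>

lemma block_mat_separation:
  assumes "1 \<le> r" "r \<le> min m1 m2" "S \<subseteq> {..<max m1 m2} \<times> {..<r}" "S' \<subseteq> {..<max m1 m2} \<times> {..<r}"
  shows "\<tau>\<^sup>2 * real (min m1 m2) * real (card (sym_diff S S'))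
          \<le> 2 * real r * (\<Sum>k\<in>{..<m1} \<times> {..<m2}. (block_mat m1 m2 r \<tau> S $$ k - block_mat m1 m2 r \<tau> S' $$ k)\<^sup>2)"
proof -
  let ?K = "{..<m1} \<times> {..<m2}" and ?D = "sym_diff S S'"
  let ?F = "\<lambda>b. {k \<in> ?K. block_pos m1 m2 r k = b}"
  have fin: "finite ?D" using assms(3,4) by (meson finite_SigmaI finite_lessThan finite_subset
      finite_Diff finite_UnI)
  have "(\<Sum>k\<in>?K. (block_mat m1 m2 r \<tau> S $$ k - block_mat m1 m2 r \<tau> S' $$ k)\<^sup>2)
      = (\<Sum>k\<in>?K. if block_pos m1 m2 r k \<in> ?D then \<tau>\<^sup>2 else 0)"
    by (intro sum.cong refl) (auto simp: block_mat_def)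
  also have "\<dots> = \<tau>\<^sup>2 * card {k \<in> ?K. block_pos m1 m2 r k \<in> ?D}"
    by (subst sum.If_cases) (auto simp: Int_def)
  also have "{k \<in> ?K. block_pos m1 m2 r k \<in> ?D} = (\<Union>b\<in>?D. ?F b)" by auto
  also have "card \<dots> = (\<Sum>b\<in>?D. card (?F b))"
    by (rule card_UN_disjoint) (use fin in auto)
  finally have eq: "(\<Sum>k\<in>?K. (block_mat m1 m2 r \<tau> S $$ k - block_mat m1 m2 r \<tau> S' $$ k)\<^sup>2)
     = \<tau>\<^sup>2 * real (\<Sum>b\<in>?D. card (?F b))" .
  have "card ?D * min m1 m2 = (\<Sum>b\<in>?D. min m1 m2)" by simp
  also have "\<dots> \<le> (\<Sum>b\<in>?D. 2 * r * card (?F b))"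
    by (rule sum_mono, rule card_block_pos_fibre) (use assms in auto)
  also have "\<dots> = 2 * r * (\<Sum>b\<in>?D. card (?F b))" by (simp add: sum_distrib_left)
  finally have "real (card ?D * min m1 m2) \<le> real (2 * r * (\<Sum>b\<in>?D. card (?F b)))"
    by (simp only: of_nat_le_iff)
  then have "\<tau>\<^sup>2 * real (card ?D * min m1 m2) \<le> \<tau>\<^sup>2 * real (2 * r * (\<Sum>b\<in>?D. card (?F b)))"
    by (rule mult_left_mono) simp
  then show ?thesis unfolding eq by (simp add: mult_ac)
qed

section \<open>Counting patterns in a Hamming ball\<close>

lemma sum_Pow_power_card:
  fixes x :: real
  assumes "finite B"
  shows "(\<Sum>U\<in>Pow B. x ^ card U) = (1 + x) ^ card B"
  using prod_add[OF assms, of "\<lambda>_. x" "\<lambda>_. 1"] by (simp add: add.commute)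

text \<open>Symmetric difference with \<open>S0\<close> moves the centre to the empty set. An
  exponential weight with base 8 is at least 1 on the ball and sums over all subsets to 8^(D/48)
  (9/8)^D, where D is the size of \<open>B\<close>. As 9/8 is at most 2^(3/16), the exponents of 2
  add up to D/16 + 3D/16 = D/4.\<close>

lemma card_hamming_ball_le:
  assumes fin: "finite B" and S0: "S0 \<subseteq> B"
  shows "real (card {S \<in> Pow B. 48 * card (sym_diff S S0) < card B}) \<le> 2 powr (real (card B) / 4)"
proof -
  let ?D = "real (card B)"
  let ?U = "{U \<in> Pow B. 48 * card U < card B}"
  have "inj_on (\<lambda>S. sym_diff S S0) {S \<in> Pow B. 48 * card (sym_diff S S0) < card B}"
    by (rule inj_onI) blast
  then have "card {S \<in> Pow B. 48 * card (sym_diff S S0) < card B} \<le> card ?U"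
    by (rule card_inj_on_le) (use fin S0 in auto)
  then have "real (card {S \<in> Pow B. 48 * card (sym_diff S S0) < card B}) \<le> (\<Sum>U\<in>?U. 1)"
    by simp
  also have "\<dots> \<le> (\<Sum>U\<in>?U. 8 powr (?D / 48) * (1 / 8) ^ card U)"
  proof (rule sum_mono)
    fix U assume "U \<in> ?U"
    then have "48 * real (card U) \<le> ?D"
      by (metis (mono_tags, lifting) mem_Collect_eq of_nat_le_iff of_nat_mult of_nat_numeral less_imp_le)
    then have "(8::real) powr real (card U) \<le> 8 powr (?D / 48)"
      by (intro powr_mono) auto
    then show "1 \<le> 8 powr (?D / 48) * (1 / 8) ^ card U"
      by (simp add: powr_realpow power_divide field_simps)
  qed
  also have "\<dots> \<le> (\<Sum>U\<in>Pow B. 8 powr (?D / 48) * (1 / 8) ^ card U)"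
    by (rule sum_mono2) (use fin in auto)
  also have "\<dots> = 8 powr (?D / 48) * (9 / 8) powr ?D"
    using sum_Pow_power_card[OF fin, of "1 / 8"] by (simp add: sum_distrib_left[symmetric] powr_realpow)
  also have "\<dots> \<le> 8 powr (?D / 48) * (8 powr (1 / 16)) powr ?D"
  proof (intro mult_left_mono powr_mono2)
    \<comment> \<open>Raising to the power 16 leaves the rational comparison of (9/8)^16 with
      8.\<close>
    have "(9 / 8 :: real) = ((9 / 8) ^ 16) powr (1 / 16)"
      by (simp add: powr_powr flip: powr_numeral)
    also have "\<dots> \<le> 8 powr (1 / 16)" by (rule powr_mono2) (auto simp: eval_nat_numeral)
    finally show "(9 / 8 :: real) \<le> 8 powr (1 / 16)" .
  qed auto
  also have "\<dots> = (2 powr 3) powr (?D / 48) * ((2 powr 3) powr (1 / 16)) powr ?D" by simp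
  also have "\<dots> = 2 powr (?D / 4)"
    unfolding powr_powr powr_add[symmetric] by (rule arg_cong[where f = "\<lambda>t. 2 powr t"]) simp
  finally show ?thesis .
qed

section \<open>Change of measure for overlapping events\<close>

text \<open>Under \<open>p\<close> the events have total mass at most \<open>V\<close>, their
  maximal multiplicity. Replacing \<open>p\<close> by the \<open>q t\<close> changes the total by a
  sum of differences, which Cauchy--Schwarz controls by the chi-square divergences and that same
  mass.\<close>

lemma sum_overlapping_events_le:
  fixes p :: "'w \<Rightarrow> real" and q :: "'t \<Rightarrow> 'w \<Rightarrow> real"
  assumes W: "finite W" and T: "finite T"
    and p: "\<And>w. w \<in> W \<Longrightarrow> 0 \<le> p w" "sum p W = 1"
    and q: "\<And>t. t \<in> T \<Longrightarrow> sum (q t) W = 1"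
    and ac: "\<And>t w. t \<in> T \<Longrightarrow> w \<in> W \<Longrightarrow> p w = 0 \<Longrightarrow> q t w = 0"
    and chi: "\<And>t. t \<in> T \<Longrightarrow> (\<Sum>w\<in>W. (q t w)\<^sup>2 / p w) \<le> 1 + C"
    and A: "\<And>t. t \<in> T \<Longrightarrow> A t \<subseteq> W"
    and V: "\<And>w. w \<in> W \<Longrightarrow> real (card {t \<in> T. w \<in> A t}) \<le> V"
  shows "(\<Sum>t\<in>T. sum (q t) (A t)) \<le> V + sqrt (C * card T * V)"
proof -
  have finA: "finite (A t)" if "t \<in> T" for t using A[OF that] W finite_subset by blast
  have pA: "(\<Sum>t\<in>T. sum p (A t)) \<le> V"
  proof -
    have "(\<Sum>t\<in>T. sum p (A t)) = (\<Sum>t\<in>T. \<Sum>w\<in>W. if w \<in> A t then p w else 0)"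
      by (rule sum.cong[OF refl]) (simp add: sum.inter_restrict[OF W, symmetric] Int_absorb1[OF A])
    also have "\<dots> = (\<Sum>w\<in>W. \<Sum>t\<in>T. if w \<in> A t then p w else 0)" by (rule sum.swap)
    also have "\<dots> = (\<Sum>w\<in>W. p w * card {t \<in> T. w \<in> A t})"
      by (intro sum.cong refl) (use T in \<open>simp add: sum.If_cases Int_def\<close>)
    also have "\<dots> \<le> (\<Sum>w\<in>W. p w * V)" by (intro sum_mono mult_left_mono V p)
    also have "\<dots> = V" using p(2) by (simp add: sum_distrib_right[symmetric])
    finally show ?thesis .
  qed
  have pA0: "0 \<le> (\<Sum>t\<in>T. sum p (A t))"
    by (intro sum_nonneg) (use A p in blast)
  have chi': "(\<Sum>w\<in>A t. ((q t w - p w) / sqrt (p w))\<^sup>2) \<le> C" if t: "t \<in> T" for t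
  proof -
    have "(\<Sum>w\<in>A t. ((q t w - p w) / sqrt (p w))\<^sup>2) \<le> (\<Sum>w\<in>W. ((q t w - p w) / sqrt (p w))\<^sup>2)"
      by (rule sum_mono2) (use A[OF t] W in auto)
    also have "\<dots> = (\<Sum>w\<in>W. (q t w)\<^sup>2 / p w - 2 * q t w + p w)"
    proof (intro sum.cong refl)
      fix w assume w: "w \<in> W"
      \<comment> \<open>Where \<open>p w = 0\<close>, division by zero returns 0 and
        \<open>ac\<close> gives \<open>q t w = 0\<close>, so both sides vanish.\<close>
      show "((q t w - p w) / sqrt (p w))\<^sup>2 = (q t w)\<^sup>2 / p w - 2 * q t w + p w"
        using p(1)[OF w] ac[OF t w]
        by (cases "p w = 0") (auto simp: power_divide field_simps power2_eq_square)
    qed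
    also have "\<dots> = (\<Sum>w\<in>W. (q t w)\<^sup>2 / p w) - 1"
      using q[OF t] p(2) by (simp add: sum.distrib sum_subtractf sum_distrib_left[symmetric])
    also have "\<dots> \<le> C" using chi[OF t] by simp
    finally show ?thesis .
  qed
  \<comment> \<open>A single Cauchy--Schwarz over all pairs of an index and a point in its event
    keeps \<open>card T\<close> and \<open>V\<close> under one root.\<close>
  let ?S = "Sigma T A"
  have Sig: "(\<Sum>t\<in>T. \<Sum>w\<in>A t. h t w) = (\<Sum>(t, w)\<in>?S. h t w)" for h :: "'t \<Rightarrow> 'w \<Rightarrow> real"
    by (rule sum.Sigma) (use T finA in auto)
  have "(\<Sum>t\<in>T. sum (q t) (A t)) - (\<Sum>t\<in>T. sum p (A t)) = (\<Sum>t\<in>T. \<Sum>w\<in>A t. q t w - p w)"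
    by (simp add: sum_subtractf)
  also have "\<dots> = (\<Sum>t\<in>T. \<Sum>w\<in>A t. ((q t w - p w) / sqrt (p w)) * sqrt (p w))"
    by (intro sum.cong refl) (use ac A in auto)
  also have "\<dots> = (\<Sum>z\<in>?S. ((q (fst z) (snd z) - p (snd z)) / sqrt (p (snd z))) * sqrt (p (snd z)))"
    unfolding Sig by (simp add: case_prod_beta)
  also have "\<dots> \<le> sqrt ((\<Sum>z\<in>?S. ((q (fst z) (snd z) - p (snd z)) / sqrt (p (snd z)))\<^sup>2) *
      (\<Sum>z\<in>?S. (sqrt (p (snd z)))\<^sup>2))"
    by (rule real_le_rsqrt, rule Cauchy_Schwarz_ineq_sum)
  also have "(\<Sum>z\<in>?S. ((q (fst z) (snd z) - p (snd z)) / sqrt (p (snd z)))\<^sup>2)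
     = (\<Sum>t\<in>T. \<Sum>w\<in>A t. ((q t w - p w) / sqrt (p w))\<^sup>2)"
    unfolding Sig by (simp add: case_prod_beta)
  also have "(\<Sum>z\<in>?S. (sqrt (p (snd z)))\<^sup>2) = (\<Sum>t\<in>T. \<Sum>w\<in>A t. (sqrt (p w))\<^sup>2)"
    unfolding Sig by (simp add: case_prod_beta)
  also have "\<dots> = (\<Sum>t\<in>T. sum p (A t))"
    by (intro sum.cong refl) (use A p in auto)
  also have "sqrt ((\<Sum>t\<in>T. \<Sum>w\<in>A t. ((q t w - p w) / sqrt (p w))\<^sup>2) * (\<Sum>t\<in>T. sum p (A t)))
     \<le> sqrt ((\<Sum>t\<in>T. C) * V)"
  proof (rule real_sqrt_le_mono, rule mult_mono)
    show "(\<Sum>t\<in>T. \<Sum>w\<in>A t. ((q t w - p w) / sqrt (p w))\<^sup>2) \<le> (\<Sum>t\<in>T. C)"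
      by (intro sum_mono chi')
    moreover have "0 \<le> (\<Sum>t\<in>T. \<Sum>w\<in>A t. ((q t w - p w) / sqrt (p w))\<^sup>2)"
      by (intro sum_nonneg) auto
    ultimately show "0 \<le> (\<Sum>t\<in>T. C)" by linarith
  qed (use pA pA0 in auto)
  finally show ?thesis using pA by (simp add: mult_ac)
qed

text \<open>Points of the product are boxes with singleton sides, hence measurable with product
  mass. The product space is countable, which makes every subset measurable, and the law is
  concentrated on the finite set of functions into \<Omega>.\<close>

lemma measure_PiM_pmf_eq_sum:
  fixes q :: "'a::countable pmf"
  assumes I: "finite I" and \<Omega>: "finite \<Omega>" "set_pmf q \<subseteq> \<Omega>" and A: "A \<subseteq> I \<rightarrow>\<^sub>E UNIV"
  shows "A \<in> sets (PiM I (\<lambda>_. measure_pmf q))"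
    and "measure (PiM I (\<lambda>_. measure_pmf q)) A = (\<Sum>d\<in>A \<inter> (I \<rightarrow>\<^sub>E \<Omega>). \<Prod>i\<in>I. pmf q (d i))"
proof -
  let ?M = "PiM I (\<lambda>_. measure_pmf q)"
  interpret finite_product_prob_space "\<lambda>_. measure_pmf q" I
    by standard (use I in auto)
  have box: "I \<rightarrow>\<^sub>E B \<in> sets ?M" for B :: "'a set"
    by (rule sets_PiM_I_finite) (use I in auto)
  have single: "PiE I (\<lambda>i. {d i}) = {d}" if "d \<in> I \<rightarrow>\<^sub>E UNIV" for d :: "'b \<Rightarrow> 'a"
    using that by (intro PiE_singleton) (simp add: PiE_def)
  have single_sets: "{d} \<in> sets ?M" if "d \<in> I \<rightarrow>\<^sub>E UNIV" for d
    using sets_PiM_I_finite[OF I, of "\<lambda>i. {d i}" "\<lambda>_. measure_pmf q"] single[OF that] by simp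
  have sets: "B \<in> sets ?M" if "B \<subseteq> I \<rightarrow>\<^sub>E UNIV" for B
    by (rule sets.countable) (use that single_sets I in \<open>auto intro: countable_subset[OF that] countable_PiE\<close>)
  show "A \<in> sets ?M" by (rule sets[OF A])
  have mass: "measure ?M {d} = (\<Prod>i\<in>I. pmf q (d i))" if "d \<in> I \<rightarrow>\<^sub>E UNIV" for d
    using finite_measure_PiM_emb[of "\<lambda>i. {d i}"] single[OF that] by (simp add: measure_pmf_single)
  have "measure ?M (I \<rightarrow>\<^sub>E \<Omega>) = (\<Prod>i\<in>I. measure q \<Omega>)"
    by (rule finite_measure_PiM_emb) simp
  also have "measure q \<Omega> = 1" using \<Omega>(2) by (simp add: measure_pmf.prob_eq_1 AE_measure_pmf_iff subset_iff)
  finally have "AE d in ?M. d \<in> I \<rightarrow>\<^sub>E \<Omega>"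
    using P.prob_eq_1[OF box] by simp
  then have "measure ?M A = measure ?M (A \<inter> (I \<rightarrow>\<^sub>E \<Omega>))"
    by (intro P.finite_measure_eq_AE) (auto intro: sets[OF A] sets.Int box)
  also have "\<dots> = (\<Sum>d\<in>A \<inter> (I \<rightarrow>\<^sub>E \<Omega>). measure ?M {d})"
    by (rule P.finite_measure_eq_sum_singleton)
       (use I \<Omega>(1) A in \<open>auto intro!: single_sets finite_PiE\<close>)
  also have "\<dots> = (\<Sum>d\<in>A \<inter> (I \<rightarrow>\<^sub>E \<Omega>). \<Prod>i\<in>I. pmf q (d i))"
    by (intro sum.cong refl mass) (use A in auto)
  finally show "measure ?M A = (\<Sum>d\<in>A \<inter> (I \<rightarrow>\<^sub>E \<Omega>). \<Prod>i\<in>I. pmf q (d i))" .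
qed

text \<open>For product laws the sum of squared likelihoods over reference likelihoods factorizes,
  so the bound 1 + \<beta> for one observation becomes its power with exponent
  \<open>card I\<close>.\<close>

lemma sum_prob_overlapping_events_le:
  fixes p :: "'a::countable pmf" and q :: "'t \<Rightarrow> 'a pmf"
  assumes I: "finite I" and \<Omega>: "finite \<Omega>" "set_pmf p \<subseteq> \<Omega>" and T: "finite T"
    and ac: "\<And>t. t \<in> T \<Longrightarrow> set_pmf (q t) \<subseteq> set_pmf p"
    and chi: "\<And>t. t \<in> T \<Longrightarrow> (\<Sum>x\<in>\<Omega>. (pmf (q t) x)\<^sup>2 / pmf p x) \<le> 1 + \<beta>"
    and A: "\<And>t. t \<in> T \<Longrightarrow> A t \<subseteq> I \<rightarrow>\<^sub>E UNIV"
    and V: "\<And>d. d \<in> I \<rightarrow>\<^sub>E \<Omega> \<Longrightarrow> real (card {t \<in> T. d \<in> A t}) \<le> V"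
  shows "(\<Sum>t\<in>T. measure (PiM I (\<lambda>_. measure_pmf (q t))) (A t))
           \<le> V + sqrt (((1 + \<beta>) ^ card I - 1) * card T * V)"
proof -
  let ?W = "I \<rightarrow>\<^sub>E \<Omega>"
  have prod_sum: "(\<Sum>d\<in>?W. \<Prod>i\<in>I. h (d i)) = (\<Sum>x\<in>\<Omega>. h x) ^ card I" for h :: "'a \<Rightarrow> real"
    using prod_sum_PiE[OF I, of "\<lambda>_. \<Omega>" "\<lambda>_. h"] \<Omega> by simp
  have "(\<Sum>t\<in>T. measure (PiM I (\<lambda>_. measure_pmf (q t))) (A t))
      = (\<Sum>t\<in>T. \<Sum>d\<in>A t \<inter> ?W. \<Prod>i\<in>I. pmf (q t) (d i))"
    by (intro sum.cong refl measure_PiM_pmf_eq_sum) (use I \<Omega> ac A in blast)+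
  also have "\<dots> \<le> V + sqrt (((1 + \<beta>) ^ card I - 1) * card T * V)"
  proof (rule sum_overlapping_events_le[where W = ?W and p = "\<lambda>d. \<Prod>i\<in>I. pmf p (d i)"])
    show "(\<Sum>d\<in>?W. \<Prod>i\<in>I. pmf p (d i)) = 1"
      unfolding prod_sum using \<Omega> by (simp add: sum_pmf_eq_1)
    show "(\<Sum>d\<in>?W. \<Prod>i\<in>I. pmf (q t) (d i)) = 1" if "t \<in> T" for t
      unfolding prod_sum using \<Omega> ac[OF that] by (subst sum_pmf_eq_1) auto
    show "(\<Prod>i\<in>I. pmf (q t) (d i)) = 0" if "t \<in> T" "(\<Prod>i\<in>I. pmf p (d i)) = 0" for t d
      using that ac[OF that(1)] I by (auto simp: set_pmf_iff prod_zero_iff subset_iff)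
    show "(\<Sum>d\<in>?W. (\<Prod>i\<in>I. pmf (q t) (d i))\<^sup>2 / (\<Prod>i\<in>I. pmf p (d i)))
        \<le> 1 + ((1 + \<beta>) ^ card I - 1)" if "t \<in> T" for t
    proof -
      have "(\<Sum>d\<in>?W. (\<Prod>i\<in>I. pmf (q t) (d i))\<^sup>2 / (\<Prod>i\<in>I. pmf p (d i)))
        = (\<Sum>x\<in>\<Omega>. (pmf (q t) x)\<^sup>2 / pmf p x) ^ card I"
        unfolding prod_sum[symmetric] by (simp add: prod_dividef prod_power_distrib)
      also have "\<dots> \<le> (1 + \<beta>) ^ card I"
        by (intro power_mono chi that sum_nonneg) auto
      finally show ?thesis by simp
    qed
    show "real (card {t \<in> T. d \<in> A t \<inter> ?W}) \<le> V" if "d \<in> ?W" for d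
      using V[OF that] that by simp
  qed (use I \<Omega> T in \<open>auto intro!: finite_PiE prod_nonneg\<close>)
  finally show ?thesis .
qed

section \<open>The law of one observation\<close>

lemma pmf_obs_pmf: "pmf (obs_pmf f P X) (k, y) = pmf P k * pmf (label_pmf f (X $$ k)) y"
proof -
  have "pmf (map_pmf (\<lambda>y. (x, y)) (label_pmf f (X $$ x))) (k, y)
      = (if x = k then pmf (label_pmf f (X $$ k)) y else 0)" for x
  proof (cases "x = k")
    case True
    then show ?thesis by (simp add: pmf_map_inj' inj_def)
  next
    case False
    then show ?thesis by (auto simp: pmf_eq_0_set_pmf)
  qed
  then have "pmf (obs_pmf f P X) (k, y)
      = (\<integral>x. (if x = k then pmf (label_pmf f (X $$ k)) y else 0) \<partial>measure_pmf P)"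
    unfolding obs_pmf_def pmf_bind by simp
  also have "\<dots> = (\<Sum>x\<in>{k}. (if x = k then pmf (label_pmf f (X $$ k)) y else 0) * pmf P x)"
    by (rule integral_measure_pmf_real) (auto split: if_splits)
  finally show ?thesis by simp
qed

lemma set_label_pmf: "set_pmf (label_pmf f x) \<subseteq> {1, 2}"
  by (auto simp: label_pmf_def)

lemma set_obs_pmf_subset: "set_pmf (obs_pmf f P X) \<subseteq> set_pmf P \<times> {1, 2}"
  using set_label_pmf by (fastforce simp: obs_pmf_def)

text \<open>Both labels always have positive probability, so the support is the same for all
  parameters; this supplies the absolute continuity in the change of measure.\<close>

lemma set_obs_pmf:
  assumes "link2 f" "\<And>x. 0 < fst (f x) \<and> fst (f x) < 1"
  shows "set_pmf (obs_pmf f P X) = set_pmf P \<times> {1, 2}"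
proof -
  have snd: "snd (f x) > 0" for x
    using assms(1) assms(2)[of x] unfolding link2_def by (smt (verit))
  have "pmf (label_pmf f x) y \<noteq> 0" if "y \<in> {1, 2}" for x y
    using that assms(2)[of x] snd[of x] pmf_label_pmf[OF assms(1), of x] by auto
  then have "set_pmf P \<times> {1, 2} \<subseteq> set_pmf (obs_pmf f P X)"
    by (simp add: subset_iff set_pmf_iff pmf_obs_pmf)
  then show ?thesis using set_obs_pmf_subset by blast
qed

text \<open>Given the position, the labels are Bernoulli with parameters b and a, whose chi-square
  divergence is (b - a)^2 / (a (1 - a)). The sampling distribution only averages this over
  positions.\<close>

lemma sum_obs_pmf_square_div_le:
  assumes link: "link2 f" and range: "\<And>x. 0 < fst (f x) \<and> fst (f x) < 1"
    and K: "finite K" "set_pmf P \<subseteq> K"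
    and dist: "\<And>k. k \<in> K \<Longrightarrow> (fst (f (X $$ k)) - fst (f (Z $$ k)))\<^sup>2
                 \<le> \<beta> * (fst (f (Z $$ k)) * (1 - fst (f (Z $$ k))))"
  shows "(\<Sum>x\<in>K \<times> {1, 2}. (pmf (obs_pmf f P X) x)\<^sup>2 / pmf (obs_pmf f P Z) x) \<le> 1 + \<beta>"
proof -
  have snd: "snd (f x) = 1 - fst (f x)" for x
    using link unfolding link2_def by (smt (verit))
  have "(\<Sum>x\<in>K \<times> {1, 2}. (pmf (obs_pmf f P X) x)\<^sup>2 / pmf (obs_pmf f P Z) x)
     = (\<Sum>k\<in>K. \<Sum>y\<in>{1, 2}. (pmf (obs_pmf f P X) (k, y))\<^sup>2 / pmf (obs_pmf f P Z) (k, y))"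
    by (subst sum.cartesian_product) (simp add: case_prod_beta)
  also have "\<dots> \<le> (\<Sum>k\<in>K. pmf P k * (1 + \<beta>))"
  proof (rule sum_mono)
    fix k assume k: "k \<in> K"
    define a b where "a = fst (f (Z $$ k))" and "b = fst (f (X $$ k))"
    have a: "0 < a" "a < 1" using range by (auto simp: a_def)
    have d: "(b - a)\<^sup>2 \<le> \<beta> * (a * (1 - a))" using dist[OF k] by (simp add: a_def b_def)
    have "b\<^sup>2 / a + (1 - b)\<^sup>2 / (1 - a) = 1 + (b - a)\<^sup>2 / (a * (1 - a))"
      using a by (simp add: field_simps power2_eq_square)
    also have "\<dots> \<le> 1 + \<beta>" using d a by (simp add: pos_divide_le_eq)
    finally have le: "b\<^sup>2 / a + (1 - b)\<^sup>2 / (1 - a) \<le> 1 + \<beta>" .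
    have "(\<Sum>y\<in>{1, 2}. (pmf (obs_pmf f P X) (k, y))\<^sup>2 / pmf (obs_pmf f P Z) (k, y))
        = (pmf P k * b)\<^sup>2 / (pmf P k * a) + (pmf P k * (1 - b))\<^sup>2 / (pmf P k * (1 - a))"
      using pmf_label_pmf[OF link]
      by (simp add: pmf_obs_pmf snd a_def b_def)
    \<comment> \<open>One factor \<open>pmf P k\<close> cancels; if it is 0, division by zero makes
      both sides 0.\<close>
    also have "\<dots> = pmf P k * (b\<^sup>2 / a + (1 - b)\<^sup>2 / (1 - a))"
      using a by (cases "pmf P k = 0") (simp_all add: field_simps power2_eq_square)
    also have "\<dots> \<le> pmf P k * (1 + \<beta>)" using le by (intro mult_left_mono) auto
    finally show "(\<Sum>y\<in>{1, 2}. (pmf (obs_pmf f P X) (k, y))\<^sup>2 / pmf (obs_pmf f P Z) (k, y))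
        \<le> pmf P k * (1 + \<beta>)" .
  qed
  also have "\<dots> = 1 + \<beta>"
    using sum_pmf_eq_1[OF K] by (simp add: sum_distrib_right[symmetric])
  finally show ?thesis .
qed

section \<open>Increments of the link function\<close>

text \<open>The mean value theorem and the decreasing derivative bound the increment by
  \<open>deriv h 0 * x\<close>. Squaring needs a nonnegative derivative: once negative it would stay
  so, and \<open>h\<close> would fall below 0 at a linear rate.\<close>

lemma increment_square_le:
  fixes h :: "real \<Rightarrow> real"
  assumes pos: "\<And>x. 0 \<le> h x" and diff: "\<And>x. h differentiable (at x)"
    and decr: "antimono_on {0..} (deriv h)" and "0 \<le> x"
  shows "(h x - h 0)\<^sup>2 \<le> (deriv h 0)\<^sup>2 * x\<^sup>2"
proof (cases "x = 0")
  case False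
  have D: "(h has_real_derivative deriv h y) (at y)" for y
    using diff[of y] DERIV_deriv_iff_real_differentiable by blast
  have mono: "deriv h z \<le> deriv h y" if "0 \<le> y" "y \<le> z" for y z
    using decr that by (auto simp: monotone_on_def)
  have nonneg: "0 \<le> deriv h y" if y: "0 \<le> y" for y
  proof (rule ccontr)
    assume neg: "\<not> 0 \<le> deriv h y"
    \<comment> \<open>With this \<open>t\<close>, the tangent at \<open>y\<close> reaches the value
      -1 at \<open>y + t\<close>.\<close>
    define t where "t = (h y + 1) / - deriv h y"
    have t: "t > 0" using neg pos[of y] by (simp add: t_def divide_pos_neg)
    obtain z where z: "y < z" "z < y + t" "h (y + t) - h y = (y + t - y) * deriv h z"
      using MVT2[of y "y + t" h "deriv h"] D t by auto
    have "t * deriv h z \<le> t * deriv h y" using mono[OF y] z(1) t by (intro mult_left_mono) auto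
    also have "\<dots> = - h y - 1" using neg by (simp add: t_def field_simps)
    finally have "h (y + t) < 0" using z(3) by simp
    then show False using pos[of "y + t"] by simp
  qed
  obtain z where z: "0 < z" "z < x" "h x - h 0 = (x - 0) * deriv h z"
    using MVT2[of 0 x h "deriv h"] D False \<open>0 \<le> x\<close> by auto
  have "(deriv h z)\<^sup>2 \<le> (deriv h 0)\<^sup>2"
    using mono[of 0 z] nonneg[of z] z by (intro power_mono) auto
  then show ?thesis unfolding z(3) by (simp add: power_mult_distrib mult.commute mult_left_mono)
qed simp

section \<open>Numerical bounds\<close>

text \<open>After division by 2^D, the first term is at most \<open>v\<close> and the root at most
  the square root of \<open>C * v\<close>. These account for the two summands on the right, the
  second through \<open>C * v\<close> being at most \<alpha>^2.\<close>

lemma success_count_le: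
  fixes D \<alpha> V C :: real
  assumes D: "2 \<le> D" and \<alpha>: "0 < \<alpha>" "\<alpha> < 1 / 8"
    and V: "V \<le> 2 powr (D / 4)" "0 \<le> V" and C: "C \<le> exp (\<alpha>\<^sup>2 / 4 * D) - 1" "0 \<le> C"
  shows "V + sqrt (C * 2 powr D * V) \<le> 2 powr D * (1 / (1 + 2 powr (D / 16)) + \<alpha>)"
proof -
  define v :: real where "v = 2 powr (- (3 / 4) * D)"
  have Vv: "V \<le> 2 powr D * v"
    using V(1) by (simp add: v_def powr_add[symmetric])
  have "v * (1 + 2 powr (D / 16)) = 2 powr (- (3 / 4) * D) + 2 powr (- (11 / 16) * D)"
    by (simp add: v_def distrib_left powr_add[symmetric])
  \<comment> \<open>Both exponents are at most -11/8 because \<open>D\<close> is at least 2.\<close>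
  also have "\<dots> \<le> 2 powr (- (11 / 8)) + 2 powr (- (11 / 8))"
    using D by (intro add_mono powr_mono) auto
  also have "\<dots> = 2 powr 1 * 2 powr (- (11 / 8))" by simp
  also have "\<dots> = 2 powr (- (3 / 8))" unfolding powr_add[symmetric] by simp
  also have "\<dots> \<le> (2::real) powr 0" by (rule powr_mono) auto
  finally have v1: "v \<le> 1 / (1 + 2 powr (D / 16))"
    by (simp add: pos_le_divide_eq add_pos_pos)
  define e where "e = \<alpha>\<^sup>2 / 4 * D"
  have ln2: "1 / 2 \<le> ln (2::real)" using ln2_ge_two_thirds by simp
  have "\<alpha>\<^sup>2 \<le> (1 / 8)\<^sup>2" using \<alpha> by (intro power_mono) auto
  then have a2: "\<alpha>\<^sup>2 / 4 \<le> ln 2 / 4" using ln2 by (simp add: power2_eq_square)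
  have e_le: "e \<le> ln 2 / 4 * D" unfolding e_def using a2 D by (intro mult_right_mono) auto
  have e0: "0 \<le> e" using D by (simp add: e_def)
  have "exp e * (1 - e) \<le> exp e * exp (- e)"
    using exp_ge_add_one_self[of "- e"] by (intro mult_left_mono) auto
  then have "exp e - 1 \<le> e * exp e" by (simp add: exp_minus field_simps)
  then have "C \<le> e * exp e" using C(1) unfolding e_def by linarith
  then have "C * v \<le> (e * exp e) * exp (- (3 / 4) * D * ln 2)"
    unfolding v_def powr_def by (intro mult_mono) (use e0 in auto)
  also have "\<dots> = e * exp (e - (3 / 4) * D * ln 2)"
    unfolding mult.assoc[of e] exp_add[symmetric] by simp
  \<comment> \<open>The growth of \<open>exp e\<close> uses up a quarter of the decay
    \<open>D * ln 2\<close>; half of it remains to absorb the linear factor \<open>D / 4\<close> in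
    \<open>e\<close>.\<close>
  also have "\<dots> \<le> e * exp (- (D * ln 2 / 2))"
    using e_le e0 by (intro mult_left_mono) (auto simp: field_simps)
  also have "\<dots> \<le> \<alpha>\<^sup>2"
  proof -
    have "D * (1 / 2) \<le> D * ln 2" using ln2 D by (intro mult_left_mono) auto
    then have "D / 4 \<le> exp (D * ln 2 / 2)"
      using exp_ge_add_one_self[of "D * ln 2 / 2"] by linarith
    then have "\<alpha>\<^sup>2 * (D / 4) \<le> \<alpha>\<^sup>2 * exp (D * ln 2 / 2)" by (intro mult_left_mono) auto
    then show ?thesis by (simp add: e_def exp_minus field_simps)
  qed
  finally have Cv: "C * v \<le> \<alpha>\<^sup>2" .
  have "C * 2 powr D * V \<le> C * 2 powr D * (2 powr D * v)"
    using Vv C(2) by (intro mult_left_mono) auto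
  also have "\<dots> = (2 powr D)\<^sup>2 * (C * v)" by (simp add: power2_eq_square)
  also have "\<dots> \<le> (2 powr D)\<^sup>2 * \<alpha>\<^sup>2" using Cv by (intro mult_left_mono) auto
  finally have "sqrt (C * 2 powr D * V) \<le> sqrt ((2 powr D * \<alpha>)\<^sup>2)"
    by (simp add: power_mult_distrib)
  then have "sqrt (C * 2 powr D * V) \<le> 2 powr D * \<alpha>" using \<alpha> by simp
  moreover have "2 powr D * v \<le> 2 powr D * (1 / (1 + 2 powr (D / 16)))"
    using v1 by (intro mult_left_mono) auto
  ultimately show ?thesis using Vv unfolding distrib_left by linarith
qed

text \<open>With u = 1/(1 + 2^(D/16)) the prefactor is 1 - u. Dropping the square root leaves (1 -
  u)(1 - 2\<alpha>), and u being at most 1/2 gives the claim.\<close>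

lemma delta_bound_le:
  assumes "0 < \<alpha>" and D: "D = real r * real M"
  shows "delta_bound \<alpha> r M \<le> 1 - 1 / (1 + 2 powr (D / 16)) - \<alpha>"
proof -
  define u :: real where "u = 1 / (1 + 2 powr (D / 16))"
  have x: "1 \<le> (2::real) powr (D / 16)" using D by (intro ge_one_powr_ge_zero) auto
  have u: "u \<le> 1 / 2" using x by (simp add: u_def field_simps)
  have eq: "1 / (1 + 2 powr (- (real r * real M) / 16)) = 1 - u"
    using x by (simp add: u_def D powr_minus field_simps)
  have "delta_bound \<alpha> r M \<le> (1 - u) * (1 - 2 * \<alpha>)"
    unfolding delta_bound_def eq using u assms by (intro mult_left_mono) auto
  also have "\<dots> \<le> 1 - u - \<alpha>"
  proof -
    have "\<alpha> * u \<le> \<alpha> * (1 / 2)" using u assms by (intro mult_left_mono) auto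
    then show ?thesis by (simp add: algebra_simps)
  qed
  finally show ?thesis by (simp add: u_def)
qed

section \<open>Sample laws and the hypotheses close to one estimate\<close>

lemma space_sample_law: "space (sample_law f P n X) = {1..n} \<rightarrow>\<^sub>E UNIV"
  by (simp add: sample_law_def space_PiM)

lemma space_sample_space: "space (sample_space n) = {1..n} \<rightarrow>\<^sub>E UNIV"
  by (simp add: sample_space_def space_PiM)

lemma prob_space_sample_law: "prob_space (sample_law f P n X)"
  unfolding sample_law_def by (intro prob_space_PiM measure_pmf.prob_space_axioms)

text \<open>Two hypotheses close to \<open>Y\<close> are close to each other, so by separation their
  patterns differ in at most a fiftieth of the positions. All close patterns then lie in a Hamming
  ball around any one of them.\<close>

lemma card_close_hypotheses_le:
  assumes r: "1 \<le> r" "r \<le> min m1 m2" and Y: "Y \<in> carrier_mat m1 m2" and \<tau>: "0 < \<tau>"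
    and s: "400 * s \<le> \<tau>\<^sup>2"
  shows "real (card {S \<in> Pow ({..<max m1 m2} \<times> {..<r}).
            (frobenius_norm (Y - block_mat m1 m2 r \<tau> S))\<^sup>2 / (real m1 * real m2) \<le> s})
         \<le> 2 powr (real (max m1 m2) * real r / 4)"
    (is "real (card ?Close) \<le> _")
proof (cases "?Close = {}")
  case False
  let ?B = "{..<max m1 m2} \<times> {..<r}" and ?K = "{..<m1} \<times> {..<m2}"
  let ?X = "block_mat m1 m2 r \<tau>"
  have cardB: "real (card ?B) = real (max m1 m2) * real r"
    by (simp add: card_cartesian_product)
  have X: "?X S \<in> carrier_mat m1 m2" for S by (simp add: block_mat_def)
  have m: "0 < m1" "0 < m2" using r by auto
  have near: "(\<Sum>k\<in>?K. (Y $$ k - ?X S $$ k)\<^sup>2) \<le> s * (real m1 * real m2)" if "S \<in> ?Close" for S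
  proof -
    have "(frobenius_norm (Y - ?X S))\<^sup>2 \<le> s * (real m1 * real m2)"
      using that m by (simp add: pos_divide_le_eq)
    also have "(frobenius_norm (Y - ?X S))\<^sup>2 = (\<Sum>k\<in>?K. ((Y - ?X S) $$ k)\<^sup>2)"
      by (rule frobenius_norm_square[OF minus_carrier_mat[OF X]])
    also have "\<dots> = (\<Sum>k\<in>?K. (Y $$ k - ?X S $$ k)\<^sup>2)"
      using X[of S] Y by (intro sum.cong refl) auto
    finally show ?thesis .
  qed
  from False obtain S0 where S0: "S0 \<in> ?Close" by blast
  have "48 * card (sym_diff S S0) < card ?B" if S: "S \<in> ?Close" for S
  proof -
    have "(\<Sum>k\<in>?K. (?X S $$ k - ?X S0 $$ k)\<^sup>2)
        \<le> (\<Sum>k\<in>?K. 2 * (Y $$ k - ?X S $$ k)\<^sup>2 + 2 * (Y $$ k - ?X S0 $$ k)\<^sup>2)"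
    proof (rule sum_mono)
      fix k
      have "0 \<le> ((Y $$ k - ?X S $$ k) + (Y $$ k - ?X S0 $$ k))\<^sup>2" by simp
      then show "(?X S $$ k - ?X S0 $$ k)\<^sup>2 \<le> 2 * (Y $$ k - ?X S $$ k)\<^sup>2 + 2 * (Y $$ k - ?X S0 $$ k)\<^sup>2"
        by (simp add: power2_eq_square algebra_simps)
    qed
    also have "\<dots> \<le> 4 * (s * (real m1 * real m2))"
      using near[OF S] near[OF S0] by (simp add: sum.distrib sum_distrib_left[symmetric])
    finally have le: "(\<Sum>k\<in>?K. (?X S $$ k - ?X S0 $$ k)\<^sup>2) \<le> 4 * (s * (real m1 * real m2))" .
    have mm: "real m1 * real m2 = real (min m1 m2) * real (max m1 m2)"
      by (simp add: min_def max_def)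
    let ?c = "real (card (sym_diff S S0))"
    have "\<tau>\<^sup>2 * real (min m1 m2) * ?c \<le> 2 * real r * (\<Sum>k\<in>?K. (?X S $$ k - ?X S0 $$ k)\<^sup>2)"
      by (rule block_mat_separation) (use r S S0 in auto)
    also have "\<dots> \<le> 2 * real r * (4 * (s * (real m1 * real m2)))"
      using le by (intro mult_left_mono) auto
    \<comment> \<open>The factor 8 = 400/50 meets the assumption on \<open>s\<close>; 1/50 instead
      of 1/48 leaves room for the strict inequality of the ball.\<close>
    also have "\<dots> = 400 * s * (real r * (real m1 * real m2) / 50)" by simp
    also have "\<dots> \<le> \<tau>\<^sup>2 * (real r * (real m1 * real m2) / 50)"
      using s by (intro mult_right_mono) auto
    also have "\<dots> = \<tau>\<^sup>2 * real (min m1 m2) * (real (card ?B) / 50)"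
      unfolding mm cardB by simp
    finally have "?c \<le> real (card ?B) / 50"
      using \<tau> m by (simp add: mult_le_cancel_left_pos)
    moreover have "0 < real (card ?B)"
      unfolding cardB by (intro mult_pos_pos) (use m r in \<open>auto simp: less_max_iff_disj\<close>)
    ultimately have "real (48 * card (sym_diff S S0)) < real (card ?B)" by simp
    then show ?thesis by (simp only: of_nat_less_iff)
  qed
  then have "?Close \<subseteq> {S \<in> Pow ?B. 48 * card (sym_diff S S0) < card ?B}" by blast
  then have "card ?Close \<le> card {S \<in> Pow ?B. 48 * card (sym_diff S S0) < card ?B}"
    by (rule card_mono[rotated]) simp
  also have "real \<dots> \<le> 2 powr (real (card ?B) / 4)"
    by (rule card_hamming_ball_le) (use S0 in auto)
  finally show ?thesis unfolding cardB by simp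
next
  case True
  show ?thesis unfolding True by simp
qed

section \<open>Choice of parameters and reduction to a sum over patterns\<close>

theorem theorem3:
  fixes f :: "real \<Rightarrow> real \<times> real" and \<alpha> :: real
  assumes link: "link2 f"
    and range: "\<And>x. 0 < fst (f x) \<and> fst (f x) < 1"
    and diff: "\<And>x. (\<lambda>t. fst (f t)) differentiable (at x)"
    and K_pos: "\<And>\<gamma>. \<gamma> \<ge> 0 \<Longrightarrow> K_link f \<gamma> > 0"
    and decr: "antimono_on {0..} (deriv (\<lambda>t. fst (f t)))"
    and K_eq: "\<And>\<gamma>. \<gamma> > 0 \<Longrightarrow> K_link f \<gamma> = g_link f \<gamma>"
    and alpha: "0 < \<alpha>" "\<alpha> < 1 / 8"
  shows "\<exists>c>0. \<forall>(m1::nat) (m2::nat) (r::nat) (\<gamma>::real) (n::nat) (P :: (nat \<times> nat) pmf).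
           2 \<le> m1 \<longrightarrow> 2 \<le> m2 \<longrightarrow> 1 \<le> r \<longrightarrow> r \<le> min m1 m2 \<longrightarrow> 0 < \<gamma> \<longrightarrow> 1 \<le> n \<longrightarrow>
           set_pmf P \<subseteq> {..<m1} \<times> {..<m2} \<longrightarrow>
           minimax_risk f P n m1 m2 r \<gamma>
             (c * min (\<gamma>\<^sup>2) (real (max m1 m2) * real r / (real n * K_link f 0)))
           \<ge> delta_bound \<alpha> r (max m1 m2)"
proof (intro exI[of _ "\<alpha>\<^sup>2 / 12800"] conjI allI impI)
  \<comment> \<open>Here 12800 = 32 * 400: the 32 comes from \<tau>, where it yields the exponent
    \<open>\<alpha>\<^sup>2 / 4 * D\<close> for the divergence, and the 400 from the closeness
    threshold.\<close>
  show "0 < \<alpha>\<^sup>2 / 12800" using alpha by simp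
  fix m1 m2 r n :: nat and \<gamma> :: real and P :: "(nat \<times> nat) pmf"
  assume m: "2 \<le> m1" "2 \<le> m2" and r: "1 \<le> r" "r \<le> min m1 m2" and \<gamma>: "0 < \<gamma>" and n: "1 \<le> n"
    and P: "set_pmf P \<subseteq> {..<m1} \<times> {..<m2}"
  define h where "h = (\<lambda>t. fst (f t))"
  define K where "K = K_link f 0"
  define M where "M = max m1 m2"
  define D where "D = real M * real r"
  define \<mu> where "\<mu> = min (\<gamma>\<^sup>2) (D / (real n * K))"
  define s where "s = \<alpha>\<^sup>2 / 12800 * \<mu>"
  define \<tau> where "\<tau> = sqrt (\<alpha>\<^sup>2 / 32 * \<mu>)"
  define \<beta> where "\<beta> = 8 * K * \<tau>\<^sup>2"
  define B where "B = {..<M} \<times> {..<r}"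
  define X where "X = block_mat m1 m2 r \<tau>"
  have K: "0 < K" using K_pos[of 0] by (simp add: K_def)
  have h: "0 < h x" "h x < 1" for x using range by (auto simp: h_def)
  \<comment> \<open>The infimum at radius 0 runs over the single point 0.\<close>
  have K_eq_deriv: "8 * K * (h 0 * (1 - h 0)) = (deriv h 0)\<^sup>2"
  proof -
    have "{x::real. \<bar>x\<bar> \<le> 0} = {0}" by auto
    then have "K = (deriv h 0)\<^sup>2 / (8 * h 0 * (1 - h 0))"
      by (simp add: K_def K_link_def g_link_def h_def)
    then show ?thesis using h[of 0] by (simp add: field_simps)
  qed
  have "real 2 * real 1 \<le> real M * real r"
    using m r by (intro mult_mono) (auto simp: M_def)
  then have D: "2 \<le> D" by (simp add: D_def)
  have \<mu>: "0 < \<mu>" using \<gamma> D n K by (auto simp: \<mu>_def)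
  have \<tau>sq: "\<tau>\<^sup>2 = \<alpha>\<^sup>2 / 32 * \<mu>" using \<mu> by (simp add: \<tau>_def)
  have \<tau>: "0 < \<tau>" using \<mu> alpha by (simp add: \<tau>_def)
  have a2: "\<alpha>\<^sup>2 \<le> 1" using alpha by (intro power_le_one) auto
  have "\<tau>\<^sup>2 \<le> 1 * \<mu>"
    unfolding \<tau>sq using a2 \<mu> by (intro mult_right_mono) auto
  also have "\<dots> \<le> \<gamma>\<^sup>2" by (simp add: \<mu>_def)
  finally have \<tau>\<gamma>: "\<tau> \<le> \<gamma>" using \<gamma> by (rule power2_le_imp_le[OF _ less_imp_le])
  have s\<tau>: "400 * s \<le> \<tau>\<^sup>2" by (simp add: s_def \<tau>sq)
  have \<beta>0: "0 \<le> \<beta>" using K by (simp add: \<beta>_def)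
  have n\<beta>: "real n * \<beta> \<le> \<alpha>\<^sup>2 / 4 * D"
  proof -
    have "real n * \<beta> = \<alpha>\<^sup>2 / 4 * (\<mu> * (real n * K))" by (simp add: \<beta>_def \<tau>sq)
    also have "\<mu> * (real n * K) \<le> (D / (real n * K)) * (real n * K)"
      using K by (intro mult_right_mono) (auto simp: \<mu>_def)
    also have "\<dots> = D" using K n by simp
    finally show ?thesis by (simp add: mult_left_mono)
  qed
  have C: "(1 + \<beta>) ^ n - 1 \<le> exp (\<alpha>\<^sup>2 / 4 * D) - 1" "0 \<le> (1 + \<beta>) ^ n - 1"
  proof -
    have "(1 + \<beta>) ^ n \<le> exp \<beta> ^ n"
      using \<beta>0 exp_ge_add_one_self[of \<beta>] by (intro power_mono) auto
    also have "\<dots> = exp (real n * \<beta>)" by (simp add: exp_of_nat_mult)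
    also have "\<dots> \<le> exp (\<alpha>\<^sup>2 / 4 * D)" using n\<beta> by simp
    finally show "(1 + \<beta>) ^ n - 1 \<le> exp (\<alpha>\<^sup>2 / 4 * D) - 1" by simp
    show "0 \<le> (1 + \<beta>) ^ n - 1" using \<beta>0 by (simp add: one_le_power)
  qed
  have finB: "finite B" and cardT: "real (card (Pow B)) = 2 powr D"
    by (simp_all add: B_def card_Pow card_cartesian_product D_def powr_realpow flip: of_nat_mult)
  have X_class: "X S \<in> low_rank_class m1 m2 r \<gamma>" for S
    unfolding X_def by (rule block_mat_in_low_rank_class) (use m r \<tau> \<tau>\<gamma> in auto)

  have "delta_bound \<alpha> r M \<le> minimax_risk f P n m1 m2 r \<gamma> s"
    unfolding minimax_risk_def
  proof (rule cINF_greatest)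
    have "(\<lambda>_. 0\<^sub>m m1 m2) \<in> estimators n m1 m2" by (simp add: estimators_def)
    then show "estimators n m1 m2 \<noteq> {}" by blast
    fix Xh assume Xh: "Xh \<in> estimators n m1 m2"
    let ?loss = "\<lambda>d X. (frobenius_norm (Xh d - X))\<^sup>2 / (real m1 * real m2)"
    let ?\<Omega> = "({..<m1} \<times> {..<m2}) \<times> {1, 2 :: nat}"
    define A where "A = (\<lambda>S. {d \<in> {1..n} \<rightarrow>\<^sub>E UNIV. ?loss d (X S) \<le> s})"
    define risk where "risk = (\<lambda>X. measure (sample_law f P n X)
        {d \<in> space (sample_law f P n X). ?loss d X > s})"
    have Xh_dim: "Xh d \<in> carrier_mat m1 m2" if "d \<in> {1..n} \<rightarrow>\<^sub>E UNIV" for d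
      using Xh that unfolding estimators_def space_sample_space by blast
    \<comment> \<open>The empty pattern is the zero matrix, and all entries lie between 0 and
      \<tau>. The increment bound and \<open>K_eq_deriv\<close> thus give the one-observation
      divergence \<beta>, whatever the position.\<close>
    have dist: "(fst (f (X S $$ k)) - fst (f (X {} $$ k)))\<^sup>2
        \<le> \<beta> * (fst (f (X {} $$ k)) * (1 - fst (f (X {} $$ k))))"
      if k: "k \<in> {..<m1} \<times> {..<m2}" for S k
    proof -
      have X0: "X {} $$ k = 0" using k by (auto simp: X_def block_mat_def)
      have XS: "0 \<le> X S $$ k" "X S $$ k \<le> \<tau>" using k \<tau> by (auto simp: X_def block_mat_def)
      have "(h (X S $$ k) - h 0)\<^sup>2 \<le> (deriv h 0)\<^sup>2 * (X S $$ k)\<^sup>2"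
        by (rule increment_square_le)
           (use h diff decr XS in \<open>auto simp: h_def less_imp_le\<close>)
      also have "\<dots> \<le> (deriv h 0)\<^sup>2 * \<tau>\<^sup>2"
        using XS by (intro mult_left_mono power_mono) auto
      also have "\<dots> = \<beta> * (h 0 * (1 - h 0))"
        unfolding K_eq_deriv[symmetric] \<beta>_def by simp
      finally show ?thesis unfolding X0 h_def .
    qed
    have supp: "set_pmf (obs_pmf f P (X S)) \<subseteq> ?\<Omega>" for S
      using set_obs_pmf_subset[of f P "X S"] P by blast
    have "(\<Sum>S\<in>Pow B. measure (sample_law f P n (X S)) (A S))
        \<le> 2 powr (D / 4) + sqrt (((1 + \<beta>) ^ card {1..n} - 1) * card (Pow B) * 2 powr (D / 4))"
      unfolding sample_law_def
    proof (rule sum_prob_overlapping_events_le[where p = "obs_pmf f P (X {})" and \<Omega> = ?\<Omega>])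
      show "set_pmf (obs_pmf f P (X {})) \<subseteq> ?\<Omega>"
        by (rule supp)
      show "set_pmf (obs_pmf f P (X S)) \<subseteq> set_pmf (obs_pmf f P (X {}))" for S
        using set_obs_pmf[OF link range] by simp
      show "(\<Sum>x\<in>?\<Omega>. (pmf (obs_pmf f P (X S)) x)\<^sup>2 / pmf (obs_pmf f P (X {})) x) \<le> 1 + \<beta>" for S
        by (rule sum_obs_pmf_square_div_le[OF link range]) (use P dist in auto)
      show "real (card {S \<in> Pow B. d \<in> A S}) \<le> 2 powr (D / 4)" if d: "d \<in> {1..n} \<rightarrow>\<^sub>E ?\<Omega>" for d
      proof -
        have d': "d \<in> {1..n} \<rightarrow>\<^sub>E UNIV" using d by (auto simp: PiE_def)
        have "{S \<in> Pow B. d \<in> A S} = {S \<in> Pow B. ?loss d (X S) \<le> s}" using d' by (simp add: A_def)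
        then show ?thesis
          using card_close_hypotheses_le[OF r Xh_dim[OF d'] \<tau> s\<tau>]
          by (simp add: B_def M_def X_def D_def)
      qed
    qed (use finB in \<open>auto simp: A_def\<close>)
    also have "\<dots> = 2 powr (D / 4) + sqrt (((1 + \<beta>) ^ n - 1) * 2 powr D * 2 powr (D / 4))"
      by (simp only: cardT card_atLeastAtMost diff_Suc_1 Suc_eq_plus1[symmetric])
    also have "\<dots> \<le> 2 powr D * (1 / (1 + 2 powr (D / 16)) + \<alpha>)"
      by (rule success_count_le[OF D alpha _ _ C]) auto
    finally have total: "(\<Sum>S\<in>Pow B. measure (sample_law f P n (X S)) (A S))
        \<le> 2 powr D * (1 / (1 + 2 powr (D / 16)) + \<alpha>)" .
    \<comment> \<open>Pigeonhole over the 2^D patterns: some pattern, depending on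
      \<open>Xh\<close>, has success probability at most the average.\<close>
    obtain S where S: "measure (sample_law f P n (X S)) (A S) \<le> 1 / (1 + 2 powr (D / 16)) + \<alpha>"
    proof (rule ccontr)
      assume "\<not> thesis"
      then have "1 / (1 + 2 powr (D / 16)) + \<alpha> < measure (sample_law f P n (X S)) (A S)" for S
        using that by (meson not_le)
      then have "(\<Sum>S\<in>Pow B. 1 / (1 + 2 powr (D / 16)) + \<alpha>)
          < (\<Sum>S\<in>Pow B. measure (sample_law f P n (X S)) (A S))"
        using finB by (intro sum_strict_mono) auto
      then show False using total by (simp add: cardT)
    qed
    interpret prob_space "sample_law f P n (X S)" by (rule prob_space_sample_law)
    have "A S \<in> events"
      unfolding sample_law_def
      by (rule measure_PiM_pmf_eq_sum(1)[where \<Omega> = ?\<Omega>])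
         (use supp in \<open>auto simp: A_def\<close>)
    moreover have "{d \<in> space (sample_law f P n (X S)). ?loss d (X S) > s}
        = space (sample_law f P n (X S)) - A S"
      by (auto simp: A_def space_sample_law)
    ultimately have "risk (X S) = 1 - prob (A S)"
      unfolding risk_def by (simp only: prob_compl)
    then have "delta_bound \<alpha> r M \<le> risk (X S)"
      using S delta_bound_le[OF alpha(1), of D r M] by (simp add: D_def mult.commute)
    \<comment> \<open>The supremum is over reals, so boundedness is required; probabilities supply
      it.\<close>
    also have "\<dots> \<le> (SUP X\<in>low_rank_class m1 m2 r \<gamma>. risk X)"
    proof (rule cSUP_upper[OF X_class])
      have "risk X \<le> 1" for X
        unfolding risk_def by (rule prob_space.prob_le_1[OF prob_space_sample_law])
      then show "bdd_above (risk ` low_rank_class m1 m2 r \<gamma>)" by (rule bdd_aboveI2)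
    qed
    finally show "delta_bound \<alpha> r M \<le> (SUP X\<in>low_rank_class m1 m2 r \<gamma>.
        measure (sample_law f P n X) {d \<in> space (sample_law f P n X). ?loss d X > s})"
      by (simp add: risk_def)
  qed
  then show "delta_bound \<alpha> r (max m1 m2) \<le> minimax_risk f P n m1 m2 r \<gamma>
      (\<alpha>\<^sup>2 / 12800 * min (\<gamma>\<^sup>2) (real (max m1 m2) * real r / (real n * K_link f 0)))"
    by (simp add: s_def \<mu>_def D_def M_def K_def)
qed

end
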